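(* Let $\mathcal H$ be a real Hilbert space, let $\mu\in\,]0,\infty[$, let $n\ge 1$ be an integer, $I=\{1,\dots,n\}$, and let $\lambda_i>0$ ($i\in I$) satisfy $\sum_{i\in I}\lambda_i=1$. For each $i\in I$ let $A_i:\mathcal H\rightrightarrows\mathcal H$ be maximally monotone, and write $\mathbf A=(A_1,\dots,A_n)$, $\boldsymbol\lambda=(\lambda_1,\dots,\lambda_n)$. Then: (i) If there exists $i_0\in I$ such that $\operatorname{int}\operatorname{dom}A_{i_0}\neq\varnothing$, then $\operatorname{int}\operatorname{dom}\mathcal R_\mu(\mathbf A,\boldsymbol\lambda)\neq\varnothing$. (ii) If there exists $i_0\in I$ such that $\operatorname{dom}A_{i_0}=\mathcal H$, then $\operatorname{dom}\mathcal R_\mu(\mathbf A,\boldsymbol\lambda)=\mathcal H$. (iii) If there exists $i_0\in I$ such that $A_{i_0}$ is surjective, then $\mathcal R_\mu(\mathbf A,\boldsymbol\lambda)$ is surjective.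
   Context: For $A:\mathcal H\rightrightarrows\mathcal H$: $\operatorname{dom}A=\{x\in\mathcal H: Ax\neq\varnothing\}$; $A$ is surjective if $\bigcup_{x\in\mathcal H}Ax=\mathcal H$; and $A^{-1}$ is the set-valued mapping with $x\in A^{-1}u\Leftrightarrow u\in Ax$. Sums and scalar multiples of set-valued mappings are pointwise Minkowski operations; $\mathrm{Id}$ is the identity. The $\boldsymbol\lambda$-weighted resolvent average of $\mathbf A$ with parameter $\mu$ is the set-valued mapping $$\mathcal R_\mu(\mathbf A,\boldsymbol\lambda)=\Big(\sum_{i\in I}\lambda_i(A_i+\mu^{-1}\mathrm{Id})^{-1}\Big)^{-1}-\mu^{-1}\mathrm{Id}.$$ *)

theory Defs
  imports "HOL-Analysis.Analysis" "HOL-Library.Set_Algebras"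
begin

text \<open>
  A set-valued mapping on \<open>'a\<close> is a function \<open>'a \<Rightarrow> 'a set\<close>.
  On sets, \<open>+\<close> and \<open>\<Sum>\<close> are the Minkowski operations of
  \<^theory>\<open>HOL-Library.Set_Algebras\<close>, whereas \<open>-\<close> is set difference; the Minkowski
  difference is therefore written out in \<open>sv_diff\<close>.
  A real Hilbert space is a type of sort \<open>{real_inner, complete_space}\<close>.
\<close>

type_synonym 'a svmap = "'a \<Rightarrow> 'a set"

definition sv_dom :: "'a svmap \<Rightarrow> 'a set" where
  "sv_dom A = {x. A x \<noteq> {}}"

definition sv_surj :: "'a svmap \<Rightarrow> bool" where
  "sv_surj A \<longleftrightarrow> (\<Union>x. A x) = UNIV"

definition sv_inv :: "'a svmap \<Rightarrow> 'a svmap" where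
  "sv_inv A u = {x. u \<in> A x}"

definition sv_Id :: "'a svmap" where
  "sv_Id x = {x}"

definition sv_add :: "'a::plus svmap \<Rightarrow> 'a svmap \<Rightarrow> 'a svmap" where
  "sv_add A B x = A x + B x"

definition sv_diff :: "'a::minus svmap \<Rightarrow> 'a svmap \<Rightarrow> 'a svmap" where
  "sv_diff A B x = {a - b | a b. a \<in> A x \<and> b \<in> B x}"

definition sv_scale :: "real \<Rightarrow> 'a::real_vector svmap \<Rightarrow> 'a svmap" where
  "sv_scale c A x = (\<lambda>u. c *\<^sub>R u) ` A x"

definition sv_sum :: "('i \<Rightarrow> 'a::comm_monoid_add svmap) \<Rightarrow> 'i set \<Rightarrow> 'a svmap" where
  "sv_sum F I x = (\<Sum>i\<in>I. F i x)"

definition sv_monotone :: "'a::real_inner svmap \<Rightarrow> bool" where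
  "sv_monotone A \<longleftrightarrow>
     (\<forall>x y. \<forall>u\<in>A x. \<forall>v\<in>A y. (x - y) \<bullet> (u - v) \<ge> 0)"

definition maximally_monotone :: "'a::real_inner svmap \<Rightarrow> bool" where
  "maximally_monotone A \<longleftrightarrow>
     sv_monotone A \<and> (\<forall>B. sv_monotone B \<and> (\<forall>x. A x \<subseteq> B x) \<longrightarrow> B = A)"

definition resolvent_average ::
  "'i set \<Rightarrow> real \<Rightarrow> ('i \<Rightarrow> 'a::real_inner svmap) \<Rightarrow> ('i \<Rightarrow> real) \<Rightarrow> 'a svmap" where
  "resolvent_average I \<mu> A l =
     sv_diff
       (sv_inv (sv_sum (\<lambda>i. sv_scale (l i) (sv_inv (sv_add (A i) (sv_scale (inverse \<mu>) sv_Id)))) I))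
       (sv_scale (inverse \<mu>) sv_Id)"

end

theory Submission
  imports Defs
begin

text \<open>
  Put \<open>\<nu> = 1/\<mu>\<close>. By Minty's theorem (\<open>minty\<close>), for each maximally monotone \<open>A\<^sub>i\<close> the
  mapping \<open>(A\<^sub>i + \<nu> Id)\<inverse>\<close> is an everywhere defined, single-valued map \<open>J\<^sub>i\<close>. It is
  cocoercive with constant \<open>\<nu>\<close>, and \<open>Id - \<nu> J\<^sub>i\<close> is cocoercive with constant \<open>1\<close>; their ranges
  are \<open>dom A\<^sub>i\<close> and \<open>ran A\<^sub>i\<close>. With \<open>T = \<Sum> \<lambda>\<^sub>i J\<^sub>i\<close>, the resolvent average is
  \<open>T\<inverse> - \<nu> Id\<close>, so its domain is \<open>ran T\<close>, and its range is that of
  \<open>Id - \<nu> T = \<Sum> \<lambda>\<^sub>i (Id - \<nu> J\<^sub>i)\<close>. All three claims therefore follow from one fact about convex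
  combinations \<open>S = \<Sum> \<lambda>\<^sub>i T\<^sub>i\<close> of cocoercive maps (\<open>brezis_haraux_interior\<close>): if \<open>w\<^sub>0\<close> is interior
  to the range of \<open>T\<^sub>k\<close>, then \<open>\<lambda>\<^sub>k w\<^sub>0 + \<Sum>\<^sub>i\<^sub>\<noteq>\<^sub>k \<lambda>\<^sub>i T\<^sub>i 0\<close> is in the range of \<open>S\<close>.

  This is an instance of the Brezis--Haraux theorem. To solve \<open>S y = w\<close>, solve the regularised
  equations \<open>\<epsilon> y\<^sub>\<epsilon> + S y\<^sub>\<epsilon> = w\<close> by contraction. Cocoercivity bounds \<open>(T\<^sub>i y - T\<^sub>i a) \<bullet> y\<close>
  from below uniformly in \<open>y\<close>, which makes \<open>z \<bullet> y\<^sub>\<epsilon>\<close> bounded above for each small \<open>z\<close>; by uniform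
  boundedness \<open>y\<^sub>\<epsilon>\<close> is bounded, and monotonicity then makes it converge in norm, to a
  solution, as \<open>\<epsilon>\<close> tends to \<open>0\<close>. No weak compactness is needed.

  Minty's theorem is proved by minimising \<open>F + \<parallel>\<cdot>\<parallel>\<^sup>2/2\<close>, where \<open>F\<close> is the Fitzpatrick function of the
  mapping: the optimality condition at the minimiser \<open>(x\<^sub>0, u\<^sub>0)\<close> says that \<open>(-u\<^sub>0, -x\<^sub>0)\<close> is
  monotonically related to the graph, hence belongs to it, and that \<open>x\<^sub>0 = -u\<^sub>0\<close>.
\<close>

section \<open>Minty's theorem\<close>

lemma real_quadratic_nonneg_imp_linear_nonneg:
  fixes a b :: real
  assumes "\<And>t. 0 < t \<Longrightarrow> t < 1 \<Longrightarrow> 0 \<le> t * a + t\<^sup>2 * b"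
  shows "0 \<le> a"
proof (rule ccontr)
  assume "\<not> 0 \<le> a"
  define t where "t = min (1/2) (- a / (2 * (\<bar>b\<bar> + 1)))"
  have "0 < - a / (2 * (\<bar>b\<bar> + 1))" using \<open>\<not> 0 \<le> a\<close> by (intro divide_pos_pos) auto
  then have t: "0 < t" "t < 1" by (auto simp: t_def)
  have "t * (\<bar>b\<bar> + 1) \<le> - a / (2 * (\<bar>b\<bar> + 1)) * (\<bar>b\<bar> + 1)"
    by (rule mult_right_mono) (auto simp: t_def)
  also have "\<dots> = - a / 2" by (simp add: field_simps add_nonneg_eq_0_iff)
  finally have 1: "t * (\<bar>b\<bar> + 1) \<le> - a / 2" .
  have "t * b \<le> t * (\<bar>b\<bar> + 1)" using t by (intro mult_left_mono) auto
  with 1 have "a + t * b < 0" using \<open>\<not> 0 \<le> a\<close> by linarith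
  then have "t * (a + t * b) < 0" using t by (simp add: mult_pos_neg)
  moreover have "t * (a + t * b) = t * a + t\<^sup>2 * b" by (simp add: algebra_simps power2_eq_square)
  ultimately show False using assms[OF t] by linarith
qed

lemma norm_add_scaleR_sq:
  fixes x d :: "'a::real_inner"
  shows "(norm (x + t *\<^sub>R d))\<^sup>2 = (norm x)\<^sup>2 + 2 * t * (x \<bullet> d) + t\<^sup>2 * (norm d)\<^sup>2"
  by (simp add: power2_norm_eq_inner inner_add_left inner_add_right inner_commute
      power2_eq_square[of t] algebra_simps)

lemma norm_half_sum_sq:
  fixes z w :: "'a::real_inner"
  shows "(norm ((1/2) *\<^sub>R (z + w)))\<^sup>2 = ((norm z)\<^sup>2 + (norm w)\<^sup>2) / 2 - (norm (z - w))\<^sup>2 / 4"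
  by (simp add: power2_norm_eq_inner inner_add_left inner_add_right inner_diff_left
      inner_diff_right inner_commute field_simps)

text \<open>
  A convex lower semicontinuous function with values in \<open>]-\<infinity>, \<infinity>]\<close> is represented by its epigraph
  \<open>E\<close>, so that no infinite values occur. By strong convexity, minimising sequences of the function
  plus \<open>\<parallel>\<cdot>\<parallel>\<^sup>2/2\<close> are Cauchy.
\<close>
lemma epigraph_quadratic_minimum:
  fixes E :: "('a::{real_inner, complete_space} \<times> real) set"
  assumes ne: "E \<noteq> {}" and cl: "closed E" and cv: "convex E"
    and bd: "\<And>z r. (z, r) \<in> E \<Longrightarrow> 0 \<le> r + (norm z)\<^sup>2 / 2"
  obtains z0 r0 where "(z0, r0) \<in> E"
    "\<And>z r. (z, r) \<in> E \<Longrightarrow> r0 + (norm z0)\<^sup>2 / 2 \<le> r + (norm z)\<^sup>2 / 2"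
proof -
  define h where "h = (\<lambda>p::'a \<times> real. snd p + (norm (fst p))\<^sup>2 / 2)"
  define m where "m = Inf (h ` E)"
  have bdd: "bdd_below (h ` E)"
    using bd by (intro bdd_belowI[of _ 0]) (auto simp: h_def)
  have lower: "m \<le> h p" if "p \<in> E" for p
    unfolding m_def using bdd that by (auto intro: cInf_lower)
  have "\<exists>p\<in>E. h p < m + inverse (real (Suc n))" for n
  proof -
    have "Inf (h ` E) < m + inverse (real (Suc n))" by (simp add: m_def)
    then show ?thesis using ne cInf_lessD[of "h ` E"] by fastforce
  qed
  then obtain p where p: "\<And>n. p n \<in> E" "\<And>n. h (p n) < m + inverse (real (Suc n))"
    by metis
  \<comment> \<open>strong convexity: \<open>m\<close> is a lower bound at the midpoint of \<open>q\<close> and \<open>s\<close>\<close>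
  have gap: "(norm (fst q - fst s))\<^sup>2 \<le> 4 * (h q + h s - 2 * m)" if "q \<in> E" "s \<in> E" for q s
  proof -
    have "(1/2) *\<^sub>R q + (1/2) *\<^sub>R s \<in> E" using convexD[OF cv that, of "1/2" "1/2"] by simp
    then have "m \<le> h ((1/2) *\<^sub>R q + (1/2) *\<^sub>R s)" by (rule lower)
    also have "\<dots> = (h q + h s) / 2 - (norm (fst q - fst s))\<^sup>2 / 8"
      using norm_half_sum_sq[of "fst q" "fst s"]
      by (simp add: h_def scaleR_add_right field_simps)
    finally show ?thesis by (simp add: field_simps)
  qed
  have inv0: "(\<lambda>n. inverse (real (Suc n))) \<longlonglongrightarrow> 0" by (rule LIMSEQ_inverse_real_of_nat)
  have "Cauchy (\<lambda>n. fst (p n))"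
  proof (rule CauchyI)
    fix e :: real assume "0 < e"
    then have "eventually (\<lambda>n. inverse (real (Suc n)) < e\<^sup>2 / 8) sequentially"
      by (intro order_tendstoD[OF inv0]) auto
    then obtain M where M: "\<And>n. n \<ge> M \<Longrightarrow> inverse (real (Suc n)) < e\<^sup>2 / 8"
      by (auto simp: eventually_sequentially)
    have "norm (fst (p i) - fst (p j)) < e" if "i \<ge> M" "j \<ge> M" for i j
    proof -
      have "(norm (fst (p i) - fst (p j)))\<^sup>2 < e\<^sup>2"
        using gap[OF p(1)[of i] p(1)[of j]] p(2)[of i] p(2)[of j] M[OF that(1)] M[OF that(2)]
        by (simp add: algebra_simps)
      then show ?thesis using \<open>0 < e\<close> by (simp add: power2_less_imp_less)
    qed
    then show "\<exists>M. \<forall>i\<ge>M. \<forall>j\<ge>M. norm (fst (p i) - fst (p j)) < e" by blast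
  qed
  then obtain z0 where z0: "(\<lambda>n. fst (p n)) \<longlonglongrightarrow> z0"
    using Cauchy_convergent convergent_def by blast
  have hm: "(\<lambda>n. h (p n)) \<longlonglongrightarrow> m"
  proof (rule tendsto_sandwich[of "\<lambda>_. m" _ _ "\<lambda>n. m + inverse (real (Suc n))"])
    show "(\<lambda>n. m + inverse (real (Suc n))) \<longlonglongrightarrow> m"
      using tendsto_add[OF tendsto_const inv0, of m] by (simp del: of_nat_Suc)
    show "\<forall>\<^sub>F n in sequentially. h (p n) \<le> m + inverse (real (Suc n))"
      using p(2) by (intro always_eventually allI less_imp_le)
    show "\<forall>\<^sub>F n in sequentially. m \<le> h (p n)"
      using p(1) by (intro always_eventually allI lower)
  qed (rule tendsto_const)
  define r0 where "r0 = m - (norm z0)\<^sup>2 / 2"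
  have "(\<lambda>n. h (p n) - (norm (fst (p n)))\<^sup>2 / 2) \<longlonglongrightarrow> r0"
    unfolding r0_def by (intro tendsto_intros hm z0) simp
  then have "(\<lambda>n. snd (p n)) \<longlonglongrightarrow> r0" by (simp add: h_def)
  with z0 have "(\<lambda>n. (fst (p n), snd (p n))) \<longlonglongrightarrow> (z0, r0)" by (rule tendsto_Pair)
  then have "(z0, r0) \<in> E"
    using cl p(1) unfolding closed_sequential_limits prod.collapse by blast
  moreover have "r0 + (norm z0)\<^sup>2 / 2 \<le> r + (norm z)\<^sup>2 / 2" if "(z, r) \<in> E" for z r
    using lower[OF that] by (simp add: r0_def h_def)
  ultimately show thesis by (rule that)
qed

text \<open>
  Minty's theorem for the zero of \<open>A + Id\<close>, with \<open>A\<close> given by its graph \<open>G\<close> and maximality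
  by the absence of further points monotonically related to \<open>G\<close>.
\<close>
lemma minty_graph:
  fixes G :: "('a::{real_inner, complete_space} \<times> 'a) set"
  assumes mono: "\<And>x u y v. (x, u) \<in> G \<Longrightarrow> (y, v) \<in> G \<Longrightarrow> 0 \<le> (x - y) \<bullet> (u - v)"
    and max: "\<And>x u. (\<And>y v. (y, v) \<in> G \<Longrightarrow> 0 \<le> (x - y) \<bullet> (u - v)) \<Longrightarrow> (x, u) \<in> G"
  shows "\<exists>x. (x, - x) \<in> G"
proof -
  \<comment> \<open>the epigraph of the Fitzpatrick function \<open>F(x, u) = sup (x \<bullet> v + y \<bullet> u - y \<bullet> v)\<close>, the
    supremum being over \<open>(y, v) \<in> G\<close>\<close>
  define E where "E = {((x, u), r). \<forall>(y, v)\<in>G. x \<bullet> v + y \<bullet> u - y \<bullet> v \<le> r}"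
  have inE: "((x, u), r) \<in> E \<longleftrightarrow> (\<forall>y v. (y, v) \<in> G \<longrightarrow> x \<bullet> v + y \<bullet> u - y \<bullet> v \<le> r)" for x u r
    by (auto simp: E_def)
  \<comment> \<open>the two basic properties: \<open>F(x, u) \<ge> x \<bullet> u\<close> everywhere, with equality on \<open>G\<close>\<close>
  have G_E: "((x, u), x \<bullet> u) \<in> E" if "(x, u) \<in> G" for x u
    unfolding inE using mono[OF that]
    by (fastforce simp: inner_diff_left inner_diff_right inner_commute)
  have E_ge: "x \<bullet> u \<le> r" if "((x, u), r) \<in> E" for x u r
  proof (rule ccontr)
    assume "\<not> x \<bullet> u \<le> r"
    have "(x, u) \<in> G"
    proof (rule max)
      fix y v assume "(y, v) \<in> G"
      then have "x \<bullet> v + y \<bullet> u - y \<bullet> v \<le> r" using that inE by blast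
      then show "0 \<le> (x - y) \<bullet> (u - v)"
        using \<open>\<not> x \<bullet> u \<le> r\<close> by (simp add: inner_diff_left inner_diff_right)
    qed
    then have "x \<bullet> u + x \<bullet> u - x \<bullet> u \<le> r" using that inE by blast
    then show False using \<open>\<not> x \<bullet> u \<le> r\<close> by simp
  qed
  have "G \<noteq> {}" using max by blast
  then have "E \<noteq> {}" using G_E by fastforce
  moreover have "closed E"
  proof -
    have "E = (\<Inter>(y, v)\<in>G. {p. fst (fst p) \<bullet> v + y \<bullet> snd (fst p) - y \<bullet> v \<le> snd p})"
      by (fastforce simp: inE)
    moreover have "closed {p::('a \<times> 'a) \<times> real. fst (fst p) \<bullet> v + y \<bullet> snd (fst p) - y \<bullet> v \<le> snd p}" for y v
      by (intro closed_Collect_le continuous_intros)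
    ultimately show ?thesis by (auto intro!: closed_INT)
  qed
  moreover have "convex E"
  proof (rule convexI)
    fix p q :: "('a \<times> 'a) \<times> real" and s t :: real
    assume pq: "p \<in> E" "q \<in> E" and st: "0 \<le> s" "0 \<le> t" "s + t = 1"
    obtain x u r x' u' r' where [simp]: "p = ((x, u), r)" "q = ((x', u'), r')"
      by (metis surj_pair)
    have "(s *\<^sub>R x + t *\<^sub>R x') \<bullet> v + y \<bullet> (s *\<^sub>R u + t *\<^sub>R u') - y \<bullet> v \<le> s * r + t * r'"
      if "(y, v) \<in> G" for y v
    proof -
      have "s * (x \<bullet> v + y \<bullet> u - y \<bullet> v) + t * (x' \<bullet> v + y \<bullet> u' - y \<bullet> v) \<le> s * r + t * r'"
        using pq that st by (intro add_mono mult_left_mono) (auto simp: inE)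
      moreover have "y \<bullet> v = s * (y \<bullet> v) + t * (y \<bullet> v)"
        using st by (simp flip: distrib_right)
      ultimately show ?thesis by (simp add: inner_add_left inner_add_right algebra_simps)
    qed
    then show "s *\<^sub>R p + t *\<^sub>R q \<in> E" by (simp add: inE)
  qed
  moreover have "0 \<le> r + (norm z)\<^sup>2 / 2" if "(z, r) \<in> E" for z r
  proof -
    obtain x u where [simp]: "z = (x, u)" by (metis surj_pair)
    have "0 \<le> (x + u) \<bullet> (x + u)" by simp
    then have "0 \<le> 2 * (x \<bullet> u) + (norm x)\<^sup>2 + (norm u)\<^sup>2"
      by (simp add: inner_add_left inner_add_right inner_commute power2_norm_eq_inner)
    then show ?thesis using E_ge[of x u r] that by (simp add: norm_Pair add_divide_distrib)
  qed
  ultimately obtain z0 r0 where min: "(z0, r0) \<in> E"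
    "\<And>z r. (z, r) \<in> E \<Longrightarrow> r0 + (norm z0)\<^sup>2 / 2 \<le> r + (norm z)\<^sup>2 / 2"
    by (rule epigraph_quadratic_minimum) blast+
  obtain x0 u0 where z0: "z0 = (x0, u0)" by (metis surj_pair)
  \<comment> \<open>first-order optimality: \<open>- z0\<close> is a subgradient of \<open>F\<close> at \<open>z0\<close>\<close>
  have opt: "r0 - z0 \<bullet> (z - z0) \<le> r" if "(z, r) \<in> E" for z r
  proof -
    have "0 \<le> r - r0 + z0 \<bullet> (z - z0)"
    proof (rule real_quadratic_nonneg_imp_linear_nonneg)
      fix t :: real assume t: "0 < t" "t < 1"
      have "(1 - t) *\<^sub>R (z0, r0) + t *\<^sub>R (z, r) \<in> E"
        using convexD[OF \<open>convex E\<close> min(1) that, of "1 - t" t] t by simp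
      moreover have "(1 - t) *\<^sub>R (z0, r0) + t *\<^sub>R (z, r) = (z0 + t *\<^sub>R (z - z0), (1 - t) * r0 + t * r)"
        by (simp add: algebra_simps)
      ultimately have "r0 + (norm z0)\<^sup>2 / 2 \<le> (1 - t) * r0 + t * r + (norm (z0 + t *\<^sub>R (z - z0)))\<^sup>2 / 2"
        using min(2) by simp
      then show "0 \<le> t * (r - r0 + z0 \<bullet> (z - z0)) + t\<^sup>2 * ((norm (z - z0))\<^sup>2 / 2)"
        unfolding norm_add_scaleR_sq by (simp add: field_simps)
    qed
    then show ?thesis by simp
  qed
  have key: "(norm (x0 + u0))\<^sup>2 \<le> (- u0 - y) \<bullet> (- x0 - v)" if "(y, v) \<in> G" for y v
  proof -
    have "r0 - z0 \<bullet> ((y, v) - z0) \<le> y \<bullet> v" using opt[OF G_E[OF that]] .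
    moreover have "x0 \<bullet> u0 \<le> r0" using E_ge min(1) z0 by blast
    ultimately show ?thesis
      by (simp add: z0 inner_diff_left inner_diff_right inner_add_left inner_add_right
          inner_commute power2_norm_eq_inner)
  qed
  have "(- u0, - x0) \<in> G"
    using key by (intro max) (meson order_trans zero_le_power2)
  \<comment> \<open>the right-hand side of \<open>key\<close> vanishes at this point\<close>
  from key[OF this] have "x0 = - u0" by (simp add: eq_neg_iff_add_eq_0)
  with \<open>(- u0, - x0) \<in> G\<close> have "(x0, - x0) \<in> G" by simp
  then show ?thesis ..
qed

section \<open>Ranges of cocoercive maps\<close>

text \<open>
  The map \<open>T\<close> is \<open>c\<close>-cocoercive; for \<open>c = 1\<close> this is firm nonexpansiveness. No sign of \<open>c\<close> is part of
  the definition.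
\<close>
definition cocoercive :: "real \<Rightarrow> ('a::real_inner \<Rightarrow> 'a) \<Rightarrow> bool" where
  "cocoercive c T \<longleftrightarrow> (\<forall>x y. c * (norm (T x - T y))\<^sup>2 \<le> (T x - T y) \<bullet> (x - y))"

lemma cocoercive_lipschitz:
  assumes "cocoercive c T" "0 < c"
  shows "norm (T x - T y) \<le> norm (x - y) / c"
proof (cases "T x = T y")
  case False
  have "c * (norm (T x - T y))\<^sup>2 \<le> norm (T x - T y) * norm (x - y)"
    using assms(1) norm_cauchy_schwarz[of "T x - T y" "x - y"] unfolding cocoercive_def
    by (meson order_trans)
  then have "norm (T x - T y) * (c * norm (T x - T y)) \<le> norm (T x - T y) * norm (x - y)"
    by (simp add: power2_eq_square algebra_simps)
  then show ?thesis using False assms(2) by (simp add: field_simps)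
qed (use assms in simp)

lemma cocoercive_monotone:
  assumes "cocoercive c T" "0 < c"
  shows "0 \<le> (T x - T y) \<bullet> (x - y)"
  using assms unfolding cocoercive_def
  by (meson order_trans mult_nonneg_nonneg less_imp_le zero_le_power2)

lemma tikhonov_solvable:
  fixes T :: "'a::{real_inner, complete_space} \<Rightarrow> 'a"
  assumes coc: "cocoercive c T" and "0 < c" "0 < \<epsilon>"
  shows "\<exists>y. \<epsilon> *\<^sub>R y + T y = w"
proof -
  \<comment> \<open>the step size for which cocoercivity exactly cancels the term \<open>\<tau>\<^sup>2 \<parallel>T x - T y\<parallel>\<^sup>2\<close>\<close>
  define \<tau> where "\<tau> = 2 * c / (1 + 2 * \<epsilon> * c)"
  define g where "g = (\<lambda>y. y - \<tau> *\<^sub>R (\<epsilon> *\<^sub>R y + T y - w))"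
  have pos: "0 < 1 + 2 * \<epsilon> * c" using assms by (simp add: add_pos_pos)
  then have \<tau>: "0 < \<tau>" "\<tau> * \<epsilon> < 1" and \<tau>_eq: "2 * (1 - \<tau> * \<epsilon>) * c = \<tau>"
    using assms by (auto simp: \<tau>_def field_simps)
  have "dist (g x) (g y) \<le> (1 - \<tau> * \<epsilon>) * dist x y" for x y
  proof -
    define d t where "d = x - y" and "t = T x - T y"
    have "c * (norm t)\<^sup>2 \<le> t \<bullet> d" using coc unfolding cocoercive_def d_def t_def by blast
    then have "(2 * (1 - \<tau> * \<epsilon>) * \<tau>) * (c * (norm t)\<^sup>2) \<le> (2 * (1 - \<tau> * \<epsilon>) * \<tau>) * (t \<bullet> d)"
      using \<tau> by (intro mult_left_mono) auto
    moreover have "(2 * (1 - \<tau> * \<epsilon>) * \<tau>) * (c * (norm t)\<^sup>2) = \<tau> * (2 * (1 - \<tau> * \<epsilon>) * c) * (norm t)\<^sup>2"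
      by (simp only: mult_ac)
    moreover have "\<dots> = \<tau>\<^sup>2 * (norm t)\<^sup>2"
      unfolding \<tau>_eq power2_eq_square[of \<tau>] ..
    ultimately have 1: "\<tau>\<^sup>2 * (norm t)\<^sup>2 \<le> 2 * (1 - \<tau> * \<epsilon>) * \<tau> * (t \<bullet> d)"
      by (simp only:)
    have "g x - g y = (1 - \<tau> * \<epsilon>) *\<^sub>R d - \<tau> *\<^sub>R t"
      by (simp add: g_def d_def t_def algebra_simps)
    then have "(norm (g x - g y))\<^sup>2
        = (1 - \<tau> * \<epsilon>)\<^sup>2 * (norm d)\<^sup>2 - 2 * (1 - \<tau> * \<epsilon>) * \<tau> * (t \<bullet> d) + \<tau>\<^sup>2 * (norm t)\<^sup>2"
      by (simp only: power2_norm_eq_inner inner_diff_left inner_diff_right inner_scaleR_left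
          inner_scaleR_right inner_commute[of d t] power2_eq_square[of \<tau>]
          power2_eq_square[of "1 - \<tau> * \<epsilon>"]) (simp add: algebra_simps)
    also have "\<dots> \<le> (1 - \<tau> * \<epsilon>)\<^sup>2 * (norm d)\<^sup>2" using 1 by simp
    also have "\<dots> = ((1 - \<tau> * \<epsilon>) * norm d)\<^sup>2" by (simp add: power_mult_distrib)
    finally have "norm (g x - g y) \<le> (1 - \<tau> * \<epsilon>) * norm d"
      by (rule power2_le_imp_le) (use \<tau> in simp)
    then show ?thesis by (simp add: dist_norm d_def)
  qed
  then have "\<exists>!y. g y = y" using \<tau> assms by (intro banach_fix_type[of "1 - \<tau> * \<epsilon>"]) auto
  then obtain y where "g y = y" by blast
  then have "\<epsilon> *\<^sub>R y + T y = w" using \<tau>(1) by (simp add: g_def)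
  then show ?thesis ..
qed

text \<open>
  If the solutions of the regularised equations stay bounded, then they converge in norm. The
  reason is that \<open>\<parallel>y\<^sub>n\<parallel>\<^sup>2\<close> increases with \<open>n\<close> and that its increments dominate \<open>\<parallel>y\<^sub>n - y\<^sub>m\<parallel>\<^sup>2\<close>.
\<close>
lemma tikhonov_limit:
  fixes T :: "'a::{real_inner, complete_space} \<Rightarrow> 'a" and y :: "nat \<Rightarrow> 'a"
  assumes coc: "cocoercive c T" and "0 < c"
    and \<epsilon>: "\<And>n. 0 < \<epsilon> n" "\<And>m n. m < n \<Longrightarrow> \<epsilon> n < \<epsilon> m" "\<epsilon> \<longlonglongrightarrow> 0"
    and y: "\<And>n. \<epsilon> n *\<^sub>R y n + T (y n) = w"
    and bounded: "\<And>n. norm (y n) \<le> B"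
  shows "w \<in> range T"
proof -
  have Ty: "T (y k) = w - \<epsilon> k *\<^sub>R y k" for k
    using y[of k] by (simp add: eq_diff_eq add.commute)
  have step: "(norm (y n - y m))\<^sup>2 \<le> (norm (y n))\<^sup>2 - (norm (y m))\<^sup>2" if "m \<le> n" for m n
  proof (cases "m = n")
    case False
    then have lt: "\<epsilon> n < \<epsilon> m" using that \<epsilon>(2) by simp
    define d where "d = y n - y m"
    have "T (y m) - T (y n) = \<epsilon> n *\<^sub>R y n - \<epsilon> m *\<^sub>R y m"
      by (simp add: Ty)
    also have "\<dots> = \<epsilon> n *\<^sub>R d - (\<epsilon> m - \<epsilon> n) *\<^sub>R y m" by (simp add: d_def algebra_simps)
    finally have "0 \<le> (\<epsilon> n *\<^sub>R d - (\<epsilon> m - \<epsilon> n) *\<^sub>R y m) \<bullet> (- d)"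
      using cocoercive_monotone[OF coc \<open>0 < c\<close>, of "y m" "y n"] by (simp add: d_def)
    then have "\<epsilon> n * (norm d)\<^sup>2 \<le> (\<epsilon> m - \<epsilon> n) * (y m \<bullet> d)"
      by (simp add: inner_diff_left power2_norm_eq_inner)
    then have "0 \<le> (\<epsilon> m - \<epsilon> n) * (y m \<bullet> d)" using \<epsilon>(1)[of n]
      by (meson order_trans mult_nonneg_nonneg less_imp_le zero_le_power2)
    then have "0 \<le> y m \<bullet> d" using lt by (simp add: zero_le_mult_iff)
    moreover have "(norm (y n))\<^sup>2 = (norm (y m))\<^sup>2 + 2 * (y m \<bullet> d) + (norm d)\<^sup>2"
      by (simp add: d_def power2_norm_eq_inner inner_diff_left inner_diff_right inner_commute)
    ultimately show ?thesis by (simp add: d_def)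
  qed simp
  have "incseq (\<lambda>n. (norm (y n))\<^sup>2)"
  proof (rule incseq_SucI)
    fix n
    show "(norm (y n))\<^sup>2 \<le> (norm (y (Suc n)))\<^sup>2"
      using step[of n "Suc n"] zero_le_power2[of "norm (y (Suc n) - y n)"] by linarith
  qed
  moreover have "(norm (y n))\<^sup>2 \<le> B\<^sup>2" for n using bounded[of n] by (simp add: power_mono)
  ultimately have "convergent (\<lambda>n. (norm (y n))\<^sup>2)"
    by (metis incseq_convergent convergent_def)
  then have "Cauchy (\<lambda>n. (norm (y n))\<^sup>2)" by (rule convergent_Cauchy)
  have "Cauchy y"
  proof (rule CauchyI)
    fix e :: real assume "0 < e"
    then obtain M where M: "\<And>i j. i \<ge> M \<Longrightarrow> j \<ge> M \<Longrightarrow> norm ((norm (y i))\<^sup>2 - (norm (y j))\<^sup>2) < e\<^sup>2"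
      using CauchyD[OF \<open>Cauchy (\<lambda>n. (norm (y n))\<^sup>2)\<close>, of "e\<^sup>2"] by auto
    have lt: "norm (y j - y i) < e" if "i \<ge> M" "i \<le> j" for i j
    proof -
      have "(norm (y j - y i))\<^sup>2 < e\<^sup>2" using step[of i j] M[of j i] that by auto
      then show ?thesis using \<open>0 < e\<close> by (simp add: power2_less_imp_less)
    qed
    have "norm (y i - y j) < e" if "i \<ge> M" "j \<ge> M" for i j
      using lt[of i j] lt[of j i] that by (cases "i \<le> j") (auto simp: norm_minus_commute)
    then show "\<exists>M. \<forall>i\<ge>M. \<forall>j\<ge>M. norm (y i - y j) < e" by blast
  qed
  then obtain y0 where y0: "y \<longlonglongrightarrow> y0"
    using Cauchy_convergent convergent_def by blast
  have "(\<lambda>n. norm (y n - y0) / c) \<longlonglongrightarrow> norm (y0 - y0) / c"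
    using \<open>0 < c\<close> by (intro tendsto_intros y0) auto
  then have "(\<lambda>n. norm (y n - y0) / c) \<longlonglongrightarrow> 0" by simp
  then have "(\<lambda>n. T (y n) - T y0) \<longlonglongrightarrow> 0"
    by (rule Lim_null_comparison[OF always_eventually, rotated])
      (intro allI cocoercive_lipschitz[OF coc \<open>0 < c\<close>])
  then have T: "(\<lambda>n. T (y n)) \<longlonglongrightarrow> T y0" by (simp add: LIM_zero_cancel)
  have "(\<lambda>n. \<epsilon> n *\<^sub>R y n + T (y n)) \<longlonglongrightarrow> 0 *\<^sub>R y0 + T y0"
    by (intro tendsto_intros T \<epsilon>(3) y0)
  then have "w = T y0" using y by (simp add: LIMSEQ_const_iff)
  then show ?thesis by blast
qed

text \<open>
  The uniform boundedness principle for functionals \<open>z \<mapsto> z \<bullet> y\<^sub>n\<close>. One-sided bounds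
  suffice, since the ball of radius \<open>r\<close> is symmetric.
\<close>
lemma uniform_boundedness_inner:
  fixes y :: "nat \<Rightarrow> 'a::{real_inner, complete_space}"
  assumes "0 < r" and ptw: "\<And>z. norm z < r \<Longrightarrow> \<exists>C. \<forall>n. z \<bullet> y n \<le> C"
  shows "\<exists>B. \<forall>n. norm (y n) \<le> B"
proof -
  \<comment> \<open>closed sets that cover the space; by Baire's theorem one of them contains a ball\<close>
  define S where "S k = {z. \<forall>n. z \<bullet> y n \<le> real k}" for k :: nat
  have cl: "closed (S k)" for k
  proof -
    have "S k = (\<Inter>n. {z. z \<bullet> y n \<le> real k})" by (auto simp: S_def)
    then show ?thesis by (auto intro!: closed_INT closed_Collect_le continuous_intros)
  qed
  have cover: "z \<in> (\<Union>k. S k)" for z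
  proof -
    \<comment> \<open>a factor that scales \<open>z\<close> into the open ball of radius \<open>r\<close>\<close>
    define s where "s = r / (norm z + r)"
    have s: "0 < s" using \<open>0 < r\<close> by (simp add: s_def add_nonneg_pos)
    have "norm z + r > 0" using \<open>0 < r\<close> by (simp add: add_nonneg_pos)
    then have "norm (s *\<^sub>R z) < r"
      using \<open>0 < r\<close> s by (simp add: s_def field_simps)
    then obtain C where C: "\<And>n. s * (z \<bullet> y n) \<le> C" using ptw by fastforce
    obtain k where "C / s \<le> real k" using real_arch_simple by blast
    have "z \<bullet> y n \<le> real k" for n
    proof -
      have "z \<bullet> y n \<le> C / s" using C[of n] s by (simp add: field_simps)
      also note \<open>C / s \<le> real k\<close>
      finally show ?thesis .
    qed
    then show ?thesis by (auto simp: S_def)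
  qed
  have "\<exists>k. interior (S k) \<noteq> {}"
  proof (rule ccontr)
    assume "\<not> ?thesis"
    then have "Met_TC.mtopology interior_of (\<Union>(range S)) = {}"
      using cl by (intro Met_TC.metric_Baire_category_alt) (auto simp: complete_UNIV)
    moreover have "\<Union>(range S) = UNIV" using cover by blast
    ultimately show False by simp
  qed
  then obtain k a where "a \<in> interior (S k)" by blast
  then obtain e where e: "0 < e" "cball a e \<subseteq> S k"
    by (meson interior_subset open_contains_cball open_interior subset_trans)
  obtain k' where k': "- a \<in> S k'" using cover by blast
  have "norm (y n) \<le> (real k + real k') / e" for n
  proof (cases "y n = 0")
    case False
    have "a + (e / norm (y n)) *\<^sub>R y n \<in> cball a e" using e(1) False by (simp add: dist_norm)
    then have "(a + (e / norm (y n)) *\<^sub>R y n) \<bullet> y n \<le> real k" using e(2) by (auto simp: S_def)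
    moreover have "- a \<bullet> y n \<le> real k'" using k' by (auto simp: S_def)
    moreover have "(a + (e / norm (y n)) *\<^sub>R y n) \<bullet> y n = a \<bullet> y n + e * norm (y n)"
      using False by (simp add: inner_add_left dot_square_norm power2_eq_square)
    ultimately have "e * norm (y n) \<le> real k + real k'" by simp
    then show ?thesis using e(1) by (simp add: field_simps)
  qed (use e in simp)
  then show ?thesis by blast
qed

text \<open>
  Along the regularised solutions, \<open>T y - (w + z) = - \<epsilon> y - z\<close>; so the lower bounds assumed
  here are upper bounds for \<open>z \<bullet> y\<close>.
\<close>
lemma cocoercive_range_criterion:
  fixes T :: "'a::{real_inner, complete_space} \<Rightarrow> 'a"
  assumes coc: "cocoercive c T" and "0 < c" "0 < r"
    and rect: "\<And>z. norm z < r \<Longrightarrow> \<exists>C. \<forall>y. - C \<le> (T y - (w + z)) \<bullet> y"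
  shows "w \<in> range T"
proof -
  define \<epsilon> where "\<epsilon> n = inverse (real (Suc n))" for n
  have \<epsilon>: "0 < \<epsilon> n" for n by (simp add: \<epsilon>_def)
  have "\<forall>n. \<exists>y. \<epsilon> n *\<^sub>R y + T y = w"
    using tikhonov_solvable[OF coc \<open>0 < c\<close> \<epsilon>] by blast
  then obtain y where y: "\<And>n. \<epsilon> n *\<^sub>R y n + T (y n) = w" by metis
  have "\<exists>B. \<forall>n. norm (y n) \<le> B"
  proof (rule uniform_boundedness_inner[OF \<open>0 < r\<close>])
    fix z :: 'a assume "norm z < r"
    then obtain C where C: "\<And>y. - C \<le> (T y - (w + z)) \<bullet> y" using rect by blast
    have "z \<bullet> y n \<le> C" for n
    proof -
      have eq: "T (y n) - (w + z) = - (\<epsilon> n *\<^sub>R y n) - z" using y[of n] by (simp add: algebra_simps)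
      have "- C \<le> - (\<epsilon> n * (y n \<bullet> y n)) - z \<bullet> y n" using C[of "y n"]
        unfolding eq by (simp add: inner_diff_left)
      moreover have "0 \<le> \<epsilon> n * (y n \<bullet> y n)" using \<epsilon>[of n] by simp
      ultimately show ?thesis by linarith
    qed
    then show "\<exists>C. \<forall>n. z \<bullet> y n \<le> C" by blast
  qed
  then obtain B where "\<And>n. norm (y n) \<le> B" by blast
  moreover have "\<epsilon> n < \<epsilon> m" if "m < n" for m n using that by (simp add: \<epsilon>_def)
  moreover have "\<epsilon> \<longlonglongrightarrow> 0" unfolding \<epsilon>_def by (rule LIMSEQ_inverse_real_of_nat)
  ultimately show ?thesis by (intro tikhonov_limit[OF coc \<open>0 < c\<close> \<epsilon> _ _ y])
qed

text \<open>
  Cocoercive maps are rectangular (\<open>3\<^sup>*\<close>-monotone) in the sense of Brezis and Haraux: the lower bound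
  does not depend on \<open>y\<close>. Rectangularity is what lets the ranges of the summands be added.
\<close>
lemma cocoercive_rectangular:
  assumes "cocoercive c T" "0 < c"
  shows "- ((norm a)\<^sup>2 / (4 * c)) \<le> (T y - T a) \<bullet> y"
proof -
  define t where "t = norm (T y - T a)"
  have "c * t\<^sup>2 \<le> (T y - T a) \<bullet> (y - a)" using assms(1) by (simp add: cocoercive_def t_def)
  moreover have "- (t * norm a) \<le> (T y - T a) \<bullet> a"
    using Cauchy_Schwarz_ineq2[of "T y - T a" a] by (simp add: t_def abs_le_iff)
  ultimately have "c * t\<^sup>2 - t * norm a \<le> (T y - T a) \<bullet> y" by (simp add: inner_diff_right)
  \<comment> \<open>minimise the quadratic \<open>c t\<^sup>2 - t \<parallel>a\<parallel>\<close> in \<open>t\<close> by completing the square\<close>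
  moreover have "0 \<le> (2 * c * t - norm a)\<^sup>2 / (4 * c)" using assms(2) by simp
  moreover have "(2 * c * t - norm a)\<^sup>2 / (4 * c) = c * t\<^sup>2 - t * norm a + (norm a)\<^sup>2 / (4 * c)"
    using assms(2) by (simp add: field_simps power2_eq_square)
  ultimately show ?thesis by linarith
qed

text \<open>Jensen's inequality for \<open>\<parallel>\<cdot>\<parallel>\<^sup>2\<close>, from the nonnegativity of the variance.\<close>
lemma norm_sum_sq_le:
  fixes t :: "'i \<Rightarrow> 'a::real_inner"
  assumes "finite I" "\<And>i. i \<in> I \<Longrightarrow> 0 \<le> l i" "sum l I = 1"
  shows "(norm (\<Sum>i\<in>I. l i *\<^sub>R t i))\<^sup>2 \<le> (\<Sum>i\<in>I. l i * (norm (t i))\<^sup>2)"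
proof -
  define s where "s = (\<Sum>i\<in>I. l i *\<^sub>R t i)"
  have "0 \<le> (\<Sum>i\<in>I. l i * (norm (t i - s))\<^sup>2)" using assms by (intro sum_nonneg) auto
  also have "\<dots> = (\<Sum>i\<in>I. l i * (norm (t i))\<^sup>2 - 2 * ((l i *\<^sub>R t i) \<bullet> s) + l i * (norm s)\<^sup>2)"
    by (intro sum.cong) (simp_all add: power2_norm_eq_inner inner_diff_left inner_diff_right
        inner_commute algebra_simps)
  also have "\<dots> = (\<Sum>i\<in>I. l i * (norm (t i))\<^sup>2) - 2 * (s \<bullet> s) + sum l I * (norm s)\<^sup>2"
    by (simp add: sum.distrib sum_subtractf s_def sum_distrib_right sum_distrib_left inner_sum_left)
  finally show ?thesis using assms(3) by (simp add: s_def power2_norm_eq_inner)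
qed

lemma cocoercive_convex_combination:
  assumes "finite I" "\<And>i. i \<in> I \<Longrightarrow> 0 \<le> l i" "sum l I = 1"
    and coc: "\<And>i. i \<in> I \<Longrightarrow> cocoercive c (T i)" and "0 \<le> c"
  shows "cocoercive c (\<lambda>x. \<Sum>i\<in>I. l i *\<^sub>R T i x)"
  unfolding cocoercive_def
proof (intro allI)
  fix x y
  have eq: "(\<Sum>i\<in>I. l i *\<^sub>R T i x) - (\<Sum>i\<in>I. l i *\<^sub>R T i y) = (\<Sum>i\<in>I. l i *\<^sub>R (T i x - T i y))"
    by (simp add: sum_subtractf scaleR_diff_right)
  have "c * (norm (\<Sum>i\<in>I. l i *\<^sub>R (T i x - T i y)))\<^sup>2 \<le> c * (\<Sum>i\<in>I. l i * (norm (T i x - T i y))\<^sup>2)"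
    by (rule mult_left_mono[OF norm_sum_sq_le[OF assms(1-3)] \<open>0 \<le> c\<close>])
  also have "\<dots> = (\<Sum>i\<in>I. l i * (c * (norm (T i x - T i y))\<^sup>2))"
    by (simp add: sum_distrib_left mult_ac)
  also have "\<dots> \<le> (\<Sum>i\<in>I. l i * ((T i x - T i y) \<bullet> (x - y)))"
    using coc assms(2) by (intro sum_mono mult_left_mono) (auto simp: cocoercive_def)
  also have "\<dots> = (\<Sum>i\<in>I. l i *\<^sub>R (T i x - T i y)) \<bullet> (x - y)" by (simp add: inner_sum_left)
  finally show "c * (norm ((\<Sum>i\<in>I. l i *\<^sub>R T i x) - (\<Sum>i\<in>I. l i *\<^sub>R T i y)))\<^sup>2
      \<le> ((\<Sum>i\<in>I. l i *\<^sub>R T i x) - (\<Sum>i\<in>I. l i *\<^sub>R T i y)) \<bullet> (x - y)" unfolding eq .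
qed

text \<open>
  The inclusion of Brezis and Haraux in the case used below: only the summand \<open>k\<close> is evaluated at
  varying points, and all other summands are evaluated at \<open>0\<close>.
\<close>
lemma brezis_haraux_interior:
  fixes T :: "'i \<Rightarrow> 'a::{real_inner, complete_space} \<Rightarrow> 'a"
  assumes I: "finite I" "k \<in> I" and l: "\<And>i. i \<in> I \<Longrightarrow> 0 < l i" "sum l I = 1"
    and coc: "\<And>i. i \<in> I \<Longrightarrow> cocoercive c (T i)" and "0 < c"
    and w0: "w0 \<in> interior (range (T k))"
  shows "l k *\<^sub>R w0 + (\<Sum>i\<in>I - {k}. l i *\<^sub>R T i 0) \<in> range (\<lambda>x. \<Sum>i\<in>I. l i *\<^sub>R T i x)"
    (is "?w \<in> range ?S")
proof -
  obtain e where e: "0 < e" "ball w0 e \<subseteq> range (T k)"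
    using w0 by (meson mem_interior)
  have lk: "0 < l k" using l I by blast
  show ?thesis
  proof (rule cocoercive_range_criterion)
    show "cocoercive c ?S"
      using I l coc \<open>0 < c\<close> by (intro cocoercive_convex_combination) (auto intro: less_imp_le)
    show "0 < l k * e" using lk e by simp
    fix z :: 'a assume z: "norm z < l k * e"
    then have "w0 + z /\<^sub>R l k \<in> ball w0 e" using lk by (simp add: dist_norm field_simps)
    then obtain b where b: "T k b = w0 + z /\<^sub>R l k" using e(2) by (metis imageE subsetD)
    \<comment> \<open>points at which the combination of the values \<open>T i (a i)\<close> is exactly \<open>?w + z\<close>\<close>
    define a where "a i = (if i = k then b else 0)" for i
    have "(\<Sum>i\<in>I. l i *\<^sub>R T i (a i)) = l k *\<^sub>R T k b + (\<Sum>i\<in>I - {k}. l i *\<^sub>R T i 0)"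
      using I by (simp add: sum.remove[of I k] a_def)
    then have wz: "?w + z = (\<Sum>i\<in>I. l i *\<^sub>R T i (a i))"
      using lk by (simp add: b scaleR_add_right)
    have "- (\<Sum>i\<in>I. l i * ((norm (a i))\<^sup>2 / (4 * c))) \<le> (?S y - (?w + z)) \<bullet> y" for y
    proof -
      have "(\<Sum>i\<in>I. l i * - ((norm (a i))\<^sup>2 / (4 * c))) \<le> (\<Sum>i\<in>I. l i * ((T i y - T i (a i)) \<bullet> y))"
        using l \<open>0 < c\<close> coc
        by (intro sum_mono mult_left_mono cocoercive_rectangular) (auto intro: less_imp_le)
      also have "\<dots> = (\<Sum>i\<in>I. l i *\<^sub>R T i y - l i *\<^sub>R T i (a i)) \<bullet> y"
        by (simp add: inner_sum_left flip: scaleR_diff_right)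
      also have "\<dots> = (?S y - (?w + z)) \<bullet> y" by (simp add: wz sum_subtractf)
      finally show ?thesis by (simp add: sum_negf)
    qed
    then show "\<exists>C. \<forall>y. - C \<le> (?S y - (?w + z)) \<bullet> y" by blast
  qed fact
qed

lemma interior_range_convex_combination:
  fixes T :: "'i \<Rightarrow> 'a::{real_inner, complete_space} \<Rightarrow> 'a"
  assumes I: "finite I" "k \<in> I" and l: "\<And>i. i \<in> I \<Longrightarrow> 0 < l i" "sum l I = 1"
    and coc: "\<And>i. i \<in> I \<Longrightarrow> cocoercive c (T i)" and "0 < c"
    and ne: "interior (range (T k)) \<noteq> {}"
  shows "interior (range (\<lambda>x. \<Sum>i\<in>I. l i *\<^sub>R T i x)) \<noteq> {}"
proof -
  define b where "b = (\<Sum>i\<in>I - {k}. l i *\<^sub>R T i 0)"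
  define U where "U = (\<lambda>w. b + l k *\<^sub>R w) ` interior (range (T k))"
  have "0 < l k" using l I by blast
  then have "open U" unfolding U_def by (intro open_affinity) auto
  moreover have "U \<subseteq> range (\<lambda>x. \<Sum>i\<in>I. l i *\<^sub>R T i x)"
    using brezis_haraux_interior[OF I l coc \<open>0 < c\<close>] by (auto simp: U_def b_def add.commute)
  ultimately show ?thesis using ne interior_maximal[of U] by (auto simp: U_def)
qed

lemma surj_convex_combination:
  fixes T :: "'i \<Rightarrow> 'a::{real_inner, complete_space} \<Rightarrow> 'a"
  assumes I: "finite I" "k \<in> I" and l: "\<And>i. i \<in> I \<Longrightarrow> 0 < l i" "sum l I = 1"
    and coc: "\<And>i. i \<in> I \<Longrightarrow> cocoercive c (T i)" and "0 < c"
    and surj: "range (T k) = UNIV"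
  shows "range (\<lambda>x. \<Sum>i\<in>I. l i *\<^sub>R T i x) = UNIV"
proof -
  define b where "b = (\<Sum>i\<in>I - {k}. l i *\<^sub>R T i 0)"
  have lk: "0 < l k" using l I by blast
  have "w \<in> range (\<lambda>x. \<Sum>i\<in>I. l i *\<^sub>R T i x)" for w
  proof -
    have "(w - b) /\<^sub>R l k \<in> interior (range (T k))" using surj by simp
    from brezis_haraux_interior[where T = T and l = l, OF I l coc \<open>0 < c\<close> this] show ?thesis
      using lk by (simp add: b_def)
  qed
  then show ?thesis by blast
qed

section \<open>Resolvents\<close>

text \<open>
  Maximality, stated in terms of extensions of the mapping, gives membership of every point
  monotonically related to the graph: otherwise that point could be added.
\<close>
lemma maximally_monotone_mem:
  assumes max: "maximally_monotone A"
    and rel: "\<And>y v. v \<in> A y \<Longrightarrow> 0 \<le> (x - y) \<bullet> (u - v)"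
  shows "u \<in> A x"
proof -
  have mono: "sv_monotone A" using max by (simp add: maximally_monotone_def)
  define B where "B = A(x := insert u (A x))"
  have rel': "0 \<le> (y - x) \<bullet> (v - u)" if "v \<in> A y" for y v
    using rel[OF that] by (simp add: inner_diff_left inner_diff_right algebra_simps)
  have "sv_monotone B"
    using mono rel rel' by (auto simp: sv_monotone_def B_def)
  moreover have "\<forall>y. A y \<subseteq> B y" by (auto simp: B_def)
  ultimately have "B = A" using max by (simp add: maximally_monotone_def)
  then show ?thesis by (metis B_def fun_upd_same insertI1)
qed

lemma minty:
  fixes A :: "'a::{real_inner, complete_space} svmap"
  assumes max: "maximally_monotone A" and "0 < \<nu>"
  shows "\<exists>x. w - \<nu> *\<^sub>R x \<in> A x"
proof -
  have mono: "sv_monotone A" using max by (simp add: maximally_monotone_def)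
  \<comment> \<open>the graph of \<open>x \<mapsto> (A x - w) / \<nu>\<close>, which is again maximally monotone\<close>
  define G where "G = {(x, u). w + \<nu> *\<^sub>R u \<in> A x}"
  have "\<exists>x. (x, - x) \<in> G"
  proof (rule minty_graph)
    fix x u y v assume "(x, u) \<in> G" "(y, v) \<in> G"
    then have "0 \<le> (x - y) \<bullet> ((w + \<nu> *\<^sub>R u) - (w + \<nu> *\<^sub>R v))"
      using mono unfolding sv_monotone_def G_def by blast
    also have "\<dots> = \<nu> * ((x - y) \<bullet> (u - v))" by (simp flip: scaleR_diff_right)
    finally show "0 \<le> (x - y) \<bullet> (u - v)" using \<open>0 < \<nu>\<close> by (simp add: zero_le_mult_iff)
  next
    fix x u assume rel: "\<And>y v. (y, v) \<in> G \<Longrightarrow> 0 \<le> (x - y) \<bullet> (u - v)"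
    have "w + \<nu> *\<^sub>R u \<in> A x"
    proof (rule maximally_monotone_mem[OF max])
      fix y v assume "v \<in> A y"
      then have "(y, (v - w) /\<^sub>R \<nu>) \<in> G" using \<open>0 < \<nu>\<close> by (simp add: G_def)
      then have "0 \<le> \<nu> * ((x - y) \<bullet> (u - (v - w) /\<^sub>R \<nu>))" using rel \<open>0 < \<nu>\<close> by simp
      also have "\<dots> = (x - y) \<bullet> (\<nu> *\<^sub>R (u - (v - w) /\<^sub>R \<nu>))" by simp
      also have "\<nu> *\<^sub>R (u - (v - w) /\<^sub>R \<nu>) = w + \<nu> *\<^sub>R u - v"
        using \<open>0 < \<nu>\<close> by (simp add: scaleR_diff_right)
      finally show "0 \<le> (x - y) \<bullet> (w + \<nu> *\<^sub>R u - v)" .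
    qed
    then show "(x, u) \<in> G" by (simp add: G_def)
  qed
  then show ?thesis by (auto simp: G_def)
qed

text \<open>
  The single-valued map \<open>(A + \<nu> Id)\<inverse>\<close>. It is the usual resolvent of \<open>A / \<nu>\<close> evaluated at \<open>w / \<nu>\<close>; the
  description is well defined when \<open>A\<close> is maximally monotone and \<open>\<nu> > 0\<close>.
\<close>
definition resolvent :: "real \<Rightarrow> 'a::real_inner svmap \<Rightarrow> 'a \<Rightarrow> 'a" where
  "resolvent \<nu> A w = (THE x. w - \<nu> *\<^sub>R x \<in> A x)"

lemma monotone_shifted_inner:
  assumes "sv_monotone A" "w - \<nu> *\<^sub>R x \<in> A x" "z - \<nu> *\<^sub>R y \<in> A y"
  shows "\<nu> * (norm (x - y))\<^sup>2 \<le> (x - y) \<bullet> (w - z)"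
proof -
  have "0 \<le> (x - y) \<bullet> ((w - \<nu> *\<^sub>R x) - (z - \<nu> *\<^sub>R y))"
    using assms unfolding sv_monotone_def by blast
  then show ?thesis
    by (simp add: power2_norm_eq_inner inner_diff_left inner_diff_right algebra_simps)
qed

lemma resolvent_eq_iff:
  fixes A :: "'a::{real_inner, complete_space} svmap"
  assumes max: "maximally_monotone A" and "0 < \<nu>"
  shows "w - \<nu> *\<^sub>R x \<in> A x \<longleftrightarrow> x = resolvent \<nu> A w"
proof -
  have mono: "sv_monotone A" using max by (simp add: maximally_monotone_def)
  have unique: "x = y" if "w - \<nu> *\<^sub>R x \<in> A x" "w - \<nu> *\<^sub>R y \<in> A y" for x y
    using monotone_shifted_inner[OF mono that] \<open>0 < \<nu>\<close> by (simp add: mult_le_0_iff)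
  obtain x' where "w - \<nu> *\<^sub>R x' \<in> A x'" using minty[OF assms] by blast
  then have "w - \<nu> *\<^sub>R resolvent \<nu> A w \<in> A (resolvent \<nu> A w)"
    unfolding resolvent_def by (rule theI) (use unique \<open>w - \<nu> *\<^sub>R x' \<in> A x'\<close> in blast)
  then show ?thesis using unique by blast
qed

lemma cocoercive_resolvent:
  fixes A :: "'a::{real_inner, complete_space} svmap"
  assumes max: "maximally_monotone A" and "0 < \<nu>"
  shows "cocoercive \<nu> (resolvent \<nu> A)"
  unfolding cocoercive_def
proof (intro allI)
  fix w z
  have mono: "sv_monotone A" using max by (simp add: maximally_monotone_def)
  show "\<nu> * (norm (resolvent \<nu> A w - resolvent \<nu> A z))\<^sup>2
      \<le> (resolvent \<nu> A w - resolvent \<nu> A z) \<bullet> (w - z)"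
    using resolvent_eq_iff[OF assms] by (intro monotone_shifted_inner[OF mono]) blast+
qed

text \<open>
  For \<open>T = (A + \<nu> Id)\<inverse>\<close> the map \<open>Id - \<nu> T\<close> has range \<open>ran A\<close>; its cocoercivity makes surjectivity
  of the average a statement of the same kind as fullness of its domain.
\<close>
lemma cocoercive_complement:
  assumes "cocoercive \<nu> T" "0 < \<nu>"
  shows "cocoercive 1 (\<lambda>x. x - \<nu> *\<^sub>R T x)"
  unfolding cocoercive_def
proof (intro allI)
  fix x y
  define d t where "d = x - y" and "t = T x - T y"
  have "0 \<le> \<nu> * (t \<bullet> d - \<nu> * (norm t)\<^sup>2)"
    using assms by (simp add: cocoercive_def d_def t_def)
  then have "(norm (d - \<nu> *\<^sub>R t))\<^sup>2 \<le> (d - \<nu> *\<^sub>R t) \<bullet> d"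
    by (simp add: power2_norm_eq_inner inner_diff_left inner_diff_right inner_commute algebra_simps)
  moreover have "x - \<nu> *\<^sub>R T x - (y - \<nu> *\<^sub>R T y) = d - \<nu> *\<^sub>R t"
    by (simp add: d_def t_def algebra_simps)
  ultimately show "1 * (norm (x - \<nu> *\<^sub>R T x - (y - \<nu> *\<^sub>R T y)))\<^sup>2
      \<le> (x - \<nu> *\<^sub>R T x - (y - \<nu> *\<^sub>R T y)) \<bullet> (x - y)"
    by (simp only: d_def mult_1)
qed

lemma range_resolvent:
  fixes A :: "'a::{real_inner, complete_space} svmap"
  assumes "maximally_monotone A" "0 < \<nu>"
  shows "range (resolvent \<nu> A) = sv_dom A"
proof (intro set_eqI iffI)
  fix x assume "x \<in> range (resolvent \<nu> A)"
  then show "x \<in> sv_dom A" using resolvent_eq_iff[OF assms] by (auto simp: sv_dom_def)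
next
  fix x assume "x \<in> sv_dom A"
  then obtain u where "u \<in> A x" by (auto simp: sv_dom_def)
  then have "x = resolvent \<nu> A (u + \<nu> *\<^sub>R x)" by (simp flip: resolvent_eq_iff[OF assms])
  then show "x \<in> range (resolvent \<nu> A)" by blast
qed

lemma range_resolvent_complement:
  fixes A :: "'a::{real_inner, complete_space} svmap"
  assumes "maximally_monotone A" "0 < \<nu>"
  shows "range (\<lambda>w. w - \<nu> *\<^sub>R resolvent \<nu> A w) = (\<Union>x. A x)"
proof (intro set_eqI iffI)
  fix u assume "u \<in> range (\<lambda>w. w - \<nu> *\<^sub>R resolvent \<nu> A w)"
  then show "u \<in> (\<Union>x. A x)" using resolvent_eq_iff[OF assms] by blast
next
  fix u assume "u \<in> (\<Union>x. A x)"
  then obtain x where "u \<in> A x" by blast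
  then have "x = resolvent \<nu> A (u + \<nu> *\<^sub>R x)" by (simp flip: resolvent_eq_iff[OF assms])
  then have "u = (u + \<nu> *\<^sub>R x) - \<nu> *\<^sub>R resolvent \<nu> A (u + \<nu> *\<^sub>R x)" by simp
  then show "u \<in> range (\<lambda>w. w - \<nu> *\<^sub>R resolvent \<nu> A w)" by blast
qed

section \<open>The resolvent average\<close>

lemma sv_inv_add_scale_Id:
  fixes A :: "'a::{real_inner, complete_space} svmap"
  assumes "maximally_monotone A" "0 < \<nu>"
  shows "sv_inv (sv_add A (sv_scale \<nu> sv_Id)) w = {resolvent \<nu> A w}"
proof -
  have "w \<in> sv_add A (sv_scale \<nu> sv_Id) x \<longleftrightarrow> w - \<nu> *\<^sub>R x \<in> A x" for x
    by (auto simp: sv_add_def sv_scale_def sv_Id_def set_plus_def) (metis diff_add_cancel)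
  then show ?thesis by (auto simp: sv_inv_def resolvent_eq_iff[OF assms])
qed

lemma sum_singleton_sets:
  fixes f :: "'i \<Rightarrow> 'a::comm_monoid_add"
  shows "(\<Sum>i\<in>I. {f i}) = {\<Sum>i\<in>I. f i}"
  by (induction I rule: infinite_finite_induct) (auto simp: set_plus_def)

lemma resolvent_average_eq:
  fixes A :: "'i \<Rightarrow> 'a::{real_inner, complete_space} svmap"
  assumes "0 < \<mu>" "\<And>i. i \<in> I \<Longrightarrow> maximally_monotone (A i)"
  shows "resolvent_average I \<mu> A l x
    = {w - inverse \<mu> *\<^sub>R x | w. (\<Sum>i\<in>I. l i *\<^sub>R resolvent (inverse \<mu>) (A i) w) = x}"
proof -
  have "sv_sum (\<lambda>i. sv_scale (l i) (sv_inv (sv_add (A i) (sv_scale (inverse \<mu>) sv_Id)))) I w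
      = {\<Sum>i\<in>I. l i *\<^sub>R resolvent (inverse \<mu>) (A i) w}" for w
  proof -
    have "sv_scale (l i) (sv_inv (sv_add (A i) (sv_scale (inverse \<mu>) sv_Id))) w
        = {l i *\<^sub>R resolvent (inverse \<mu>) (A i) w}" if "i \<in> I" for i
      using assms that by (simp add: sv_scale_def[of "l i"] sv_inv_add_scale_Id)
    then show ?thesis by (simp add: sv_sum_def sum_singleton_sets)
  qed
  then show ?thesis
    by (auto simp: resolvent_average_def sv_diff_def sv_inv_def sv_scale_def[of "inverse \<mu>"] sv_Id_def)
qed

theorem theorem3p1:
  fixes A :: "nat \<Rightarrow> 'a::{real_inner, complete_space} \<Rightarrow> 'a set"
    and l :: "nat \<Rightarrow> real" and \<mu> :: real and n :: nat and I :: "nat set"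
  assumes "\<mu> > 0"
    and "n \<ge> 1"
    and "I = {1..n}"
    and "\<And>i. i \<in> I \<Longrightarrow> l i > 0"
    and "(\<Sum>i\<in>I. l i) = 1"
    and "\<And>i. i \<in> I \<Longrightarrow> maximally_monotone (A i)"
  shows "((\<exists>i0\<in>I. interior (sv_dom (A i0)) \<noteq> {})
            \<longrightarrow> interior (sv_dom (resolvent_average I \<mu> A l)) \<noteq> {})
       \<and> ((\<exists>i0\<in>I. sv_dom (A i0) = UNIV)
            \<longrightarrow> sv_dom (resolvent_average I \<mu> A l) = UNIV)
       \<and> ((\<exists>i0\<in>I. sv_surj (A i0))
            \<longrightarrow> sv_surj (resolvent_average I \<mu> A l))"
proof -
  define \<nu> where "\<nu> = inverse \<mu>"
  have \<nu>: "0 < \<nu>" using assms(1) by (simp add: \<nu>_def)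
  define J where "J i = resolvent \<nu> (A i)" for i
  define T where "T w = (\<Sum>i\<in>I. l i *\<^sub>R J i w)" for w
  have fin: "finite I" using assms(3) by simp
  have J: "cocoercive \<nu> (J i)" if "i \<in> I" for i
    unfolding J_def using that assms(6) \<nu> by (intro cocoercive_resolvent)
  have K: "cocoercive 1 (\<lambda>w. w - \<nu> *\<^sub>R J i w)" if "i \<in> I" for i
    using J[OF that] \<nu> by (rule cocoercive_complement)
  have R: "resolvent_average I \<mu> A l x = {w - \<nu> *\<^sub>R x | w. T w = x}" for x
    unfolding T_def J_def \<nu>_def using assms(1,6) by (rule resolvent_average_eq)
  have dom: "sv_dom (resolvent_average I \<mu> A l) = range T"
    by (auto simp: sv_dom_def R)
  have ran: "(\<Union>x. resolvent_average I \<mu> A l x) = range (\<lambda>w. \<Sum>i\<in>I. l i *\<^sub>R (w - \<nu> *\<^sub>R J i w))"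
  proof -
    have "(\<Sum>i\<in>I. l i *\<^sub>R (w - \<nu> *\<^sub>R J i w)) = w - \<nu> *\<^sub>R T w" for w
    proof -
      have "(\<Sum>i\<in>I. l i *\<^sub>R (w - \<nu> *\<^sub>R J i w)) = (\<Sum>i\<in>I. l i) *\<^sub>R w - (\<Sum>i\<in>I. \<nu> *\<^sub>R l i *\<^sub>R J i w)"
        by (simp add: scaleR_diff_right sum_subtractf scaleR_sum_left mult.commute)
      then show ?thesis by (simp add: assms(5) T_def scaleR_sum_right)
    qed
    then show ?thesis by (auto simp: R)
  qed
  have i: "interior (range T) \<noteq> {}" if "i0 \<in> I" "interior (sv_dom (A i0)) \<noteq> {}" for i0
    unfolding T_def
  proof (rule interior_range_convex_combination[OF fin that(1) assms(4,5) J \<nu>])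
    show "interior (range (J i0)) \<noteq> {}"
      using that assms(6) \<nu> by (simp add: J_def range_resolvent)
  qed
  have ii: "range T = UNIV" if "i0 \<in> I" "sv_dom (A i0) = UNIV" for i0
    unfolding T_def
  proof (rule surj_convex_combination[OF fin that(1) assms(4,5) J \<nu>])
    show "range (J i0) = UNIV"
      using that assms(6) \<nu> by (simp add: J_def range_resolvent)
  qed
  have iii: "(\<Union>x. resolvent_average I \<mu> A l x) = UNIV" if "i0 \<in> I" "sv_surj (A i0)" for i0
    unfolding ran
  proof (rule surj_convex_combination[OF fin that(1) assms(4,5) K zero_less_one])
    show "range (\<lambda>w. w - \<nu> *\<^sub>R J i0 w) = UNIV"
      using that assms(6) \<nu> by (simp add: J_def range_resolvent_complement sv_surj_def)
  qed
  show ?thesis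
    unfolding dom sv_surj_def[of "resolvent_average I \<mu> A l"]
    by (intro conjI impI; elim bexE) (rule i ii iii; assumption)+
qed

end
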